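(* For any position $G$, there is no position $H$ such that $G > H$.
   Context: Positions are defined recursively: $*L$ and $*R$ are terminal positions; if $G_1,\dots,G_n$ ($n\ge 1$) are positions, then $\{G_1,\dots,G_n\}$ is a position with options $G_1,\dots,G_n$. All positions have finite game trees. Play: Left and Right move alternately, each choosing any option of the current position; when a terminal position is reached, Left wins if it is $*L$ and Right wins if it is $*R$. Disjunctive sum: $*L + *L = *R + *R = *L$, $*L + *R = *R + *L = *R$; if at least one of $G,H$ is non-terminal, $G+H$ has options all $G'+H$ ($G'$ an option of $G$) and all $G+H'$ ($H'$ an option of $H$). Outcome classes: $\mathcal{L}$ (Left wins moving first or second), $\mathcal{R}$ (Right wins moving first or second), $\mathcal{N}$ (first player wins), $\mathcal{P}$ (second player wins); $o(G)$ denotes the outcome class of $G$. Outcomes are partially ordered by $\mathcal{L} > \mathcal{P} > \mathcal{R}$, $\mathcal{L} > \mathcal{N} > \mathcal{R}$, with $\mathcal{P}$ and $\mathcal{N}$ incomparable. For positions $G,H$: $G \ge H$ iff $o(G+X) \ge o(H+X)$ for every position $X$; $G \le H$ iff $o(G+X) \le o(H+X)$ for every position $X$; $G > H$ iff $G \ge H$ and not $G \le H$. *)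

theory Defs
  imports Main "HOL-Library.FSet"
begin

text \<open>
  A position with options \<open>G\<^sub>1, \<dots>, G\<^sub>n\<close> is encoded by the finite set of its options.  The datatype
  also contains trees with empty nodes \<open>Opts {||}\<close>; these are not positions (a non-terminal
  position has \<open>n \<ge> 1\<close> options) and are excluded by \<open>position\<close> below.
\<close>

datatype tree = StarL | StarR | Opts "tree fset"

inductive position :: "tree \<Rightarrow> bool" where
  position_StarL: "position StarL"
| position_StarR: "position StarR"
| position_Opts: "A \<noteq> {||} \<Longrightarrow> (\<And>G. G |\<in>| A \<Longrightarrow> position G) \<Longrightarrow> position (Opts A)"

fun options :: "tree \<Rightarrow> tree fset" where
  "options StarL = {||}"
| "options StarR = {||}"
| "options (Opts A) = A"

lemma size_option: "G' |\<in>| options G \<Longrightarrow> size G' < size G"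
proof (cases G)
  case (Opts A)
  assume "G' |\<in>| options G"
  with Opts have "Suc (size G') \<le> (\<Sum>x\<in>fset A. Suc (size x))"
    by (intro member_le_sum[of G' "fset A" "\<lambda>x. Suc (size x)"]) auto
  with Opts show ?thesis by simp
qed auto

function psum :: "tree \<Rightarrow> tree \<Rightarrow> tree" where
  "psum StarL StarL = StarL"
| "psum StarR StarR = StarL"
| "psum StarL StarR = StarR"
| "psum StarR StarL = StarR"
| "psum (Opts A) H =
     Opts ((\<lambda>G'. psum G' H) |`| A |\<union>| (\<lambda>H'. psum (Opts A) H') |`| options H)"
| "psum StarL (Opts B) = Opts ((\<lambda>H'. psum StarL H') |`| B)"
| "psum StarR (Opts B) = Opts ((\<lambda>H'. psum StarR H') |`| B)"
  by pat_completeness auto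
termination
  by (relation "measure (\<lambda>(G, H). size G + size H)")
    (auto dest: size_option size_option[of _ "Opts _", simplified])

lemma psum_nonterminal:
  assumes "G \<notin> {StarL, StarR} \<or> H \<notin> {StarL, StarR}"
  shows "psum G H = Opts ((\<lambda>G'. psum G' H) |`| options G |\<union>| (\<lambda>H'. psum G H') |`| options H)"
  using assms by (cases G; cases H) auto

lemma position_Opts_iff: "position (Opts A) \<longleftrightarrow> A \<noteq> {||} \<and> (\<forall>G. G |\<in>| A \<longrightarrow> position G)"
proof
  assume "position (Opts A)"
  then show "A \<noteq> {||} \<and> (\<forall>G. G |\<in>| A \<longrightarrow> position G)"
    by cases blast
qed (blast intro: position_Opts)

lemma position_option: "position G \<Longrightarrow> G' |\<in>| options G \<Longrightarrow> position G'"
  by (cases G) (simp_all add: position_Opts_iff)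

lemma position_psum: "position G \<Longrightarrow> position H \<Longrightarrow> position (psum G H)"
proof (induction "size G + size H" arbitrary: G H rule: less_induct)
  case less
  show ?case
  proof (cases "G \<in> {StarL, StarR} \<and> H \<in> {StarL, StarR}")
    case True
    then show ?thesis by (auto intro: position_StarL position_StarR)
  next
    case False
    let ?A = "(\<lambda>G'. psum G' H) |`| options G |\<union>| (\<lambda>H'. psum G H') |`| options H"
    have "options G \<noteq> {||} \<or> options H \<noteq> {||}"
      using False less.prems by (cases G; cases H) (simp_all add: position_Opts_iff)
    then have "?A \<noteq> {||}" by auto
    moreover have "position (psum G' H)" if "G' |\<in>| options G" for G'
      by (rule less.hyps) (use that less.prems size_option position_option in simp_all)
    moreover have "position (psum G H')" if "H' |\<in>| options H" for H'
      by (rule less.hyps) (use that less.prems size_option position_option in simp_all)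
    ultimately have "position (Opts ?A)" unfolding position_Opts_iff by blast
    with False show ?thesis by (simp only: psum_nonterminal de_Morgan_conj)
  qed
qed

datatype player = Left | Right

fun opponent :: "player \<Rightarrow> player" where
  "opponent Left = Right"
| "opponent Right = Left"

text \<open>\<open>wins p q G\<close>: player \<open>p\<close> has a winning strategy on \<open>G\<close> when player \<open>q\<close> is to move.\<close>

function wins :: "player \<Rightarrow> player \<Rightarrow> tree \<Rightarrow> bool" where
  "wins p q StarL \<longleftrightarrow> p = Left"
| "wins p q StarR \<longleftrightarrow> p = Right"
| "wins p q (Opts A) \<longleftrightarrow>
     (if p = q then \<exists>G' |\<in>| A. wins p (opponent q) G'
      else \<forall>G' |\<in>| A. wins p (opponent q) G')"
  by pat_completeness auto
termination
  by (relation "measure (\<lambda>(p, q, G). size G)")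
    (auto dest: size_option[of _ "Opts _", simplified])

lemma wins_determined: "wins (opponent p) q G \<longleftrightarrow> \<not> wins p q G"
proof (induction p q G rule: wins.induct)
  case (1 p q)
  show ?case by (cases p) simp_all
next
  case (2 p q)
  show ?case by (cases p) simp_all
next
  case (3 p q A)
  then show ?case by (cases p; cases q) auto
qed

datatype outcome = OL | OP | ON | OR

definition outcome :: "tree \<Rightarrow> outcome" where
  "outcome G =
     (if wins Left Left G \<and> wins Left Right G then OL
      else if wins Right Left G \<and> wins Right Right G then OR
      else if wins Left Left G \<and> wins Right Right G then ON
      else OP)"

lemma outcome_iff:
  "outcome G = OL \<longleftrightarrow> wins Left Left G \<and> wins Left Right G"
  "outcome G = OR \<longleftrightarrow> wins Right Left G \<and> wins Right Right G"
  "outcome G = ON \<longleftrightarrow> wins Left Left G \<and> wins Right Right G"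
  "outcome G = OP \<longleftrightarrow> wins Right Left G \<and> wins Left Right G"
  using wins_determined[of Left _ G] by (auto simp: outcome_def)

instantiation outcome :: order
begin

definition less_eq_outcome :: "outcome \<Rightarrow> outcome \<Rightarrow> bool" where
  "a \<le> b \<longleftrightarrow> a = b \<or> a = OR \<or> b = OL"

definition less_outcome :: "outcome \<Rightarrow> outcome \<Rightarrow> bool" where
  "a < b \<longleftrightarrow> a \<le> b \<and> \<not> b \<le> (a :: outcome)"

instance
  by standard (auto simp: less_eq_outcome_def less_outcome_def)

end

definition pos_ge :: "tree \<Rightarrow> tree \<Rightarrow> bool" where
  "pos_ge G H \<longleftrightarrow> (\<forall>X. position X \<longrightarrow> outcome (psum G X) \<ge> outcome (psum H X))"

definition pos_le :: "tree \<Rightarrow> tree \<Rightarrow> bool" where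
  "pos_le G H \<longleftrightarrow> (\<forall>X. position X \<longrightarrow> outcome (psum G X) \<le> outcome (psum H X))"

definition pos_gt :: "tree \<Rightarrow> tree \<Rightarrow> bool" where
  "pos_gt G H \<longleftrightarrow> pos_ge G H \<and> \<not> pos_le G H"

end

theory Submission
  imports Defs
begin

text \<open>
  Adding \<open>*R\<close> to a sum leaves the moves unchanged and swaps the winner of every finished play, so it
  swaps the roles of Left and Right.  It therefore reverses the order of outcomes, and comparing
  \<open>G\<close> and \<open>H\<close> in the contexts \<open>X + *R\<close> shows that \<open>G \<ge> H\<close> already implies \<open>G \<le> H\<close>.
\<close>

lemma options_psum_StarR: "options (psum X StarR) = (\<lambda>X'. psum X' StarR) |`| options X"
  by (cases X) auto

lemma opponent_eq_iff: "opponent p = opponent q \<longleftrightarrow> p = q"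
  by (cases p; cases q) auto

text \<open>Bracketing \<open>StarR\<close> with \<open>X\<close> makes the left-hand sum
  \<open>G\<close> plus another context, the form over which \<open>pos_ge\<close>
  quantifies.\<close>

lemma wins_psum_StarR:
  "wins p q (psum G (psum X StarR)) \<longleftrightarrow> wins (opponent p) (opponent q) (psum G X)"
proof (induction "size G + size X" arbitrary: p q G X rule: less_induct)
  case less
  show ?case
  proof (cases "G \<in> {StarL, StarR} \<and> X \<in> {StarL, StarR}")
    case True
    then show ?thesis by (cases p) auto
  next
    case False
    then have X: "G \<notin> {StarL, StarR} \<or> X \<notin> {StarL, StarR}" by blast
    then have XR: "G \<notin> {StarL, StarR} \<or> psum X StarR \<notin> {StarL, StarR}"
      by (cases X) auto
    have G': "wins p q (psum G' (psum X StarR)) \<longleftrightarrow> wins (opponent p) (opponent q) (psum G' X)"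
      if "G' |\<in>| options G" for p q G'
      using less.hyps[of G' X] size_option[OF that] by simp
    have X': "wins p q (psum G (psum X' StarR)) \<longleftrightarrow> wins (opponent p) (opponent q) (psum G X')"
      if "X' |\<in>| options X" for p q X'
      using less.hyps[of G X'] size_option[OF that] by simp
    show ?thesis
      \<comment> \<open>The options of the two sums now correspond, and swapping both players
        preserves whether \<open>p = q\<close>, so \<open>wins\<close> uses the same quantifier on
        both sides.\<close>
      unfolding psum_nonterminal[OF X] psum_nonterminal[OF XR] options_psum_StarR
      by (simp add: opponent_eq_iff ball_Un bex_Un image_image G' X')
  qed
qed

text \<open>Swapping the players exchanges \<open>OL\<close> and \<open>OR\<close> and fixes
  \<open>ON\<close> and \<open>OP\<close>, an order-reversing involution.\<close>

lemma outcome_psum_StarR_le_iff: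
  "outcome (psum G (psum X StarR)) \<le> outcome (psum H (psum X StarR)) \<longleftrightarrow>
   outcome (psum H X) \<le> outcome (psum G X)"
  using wins_determined[of Left _ "psum G X"] wins_determined[of Left _ "psum H X"]
  by (auto simp: outcome_def wins_psum_StarR less_eq_outcome_def)

lemma pos_ge_imp_pos_le: "pos_ge G H \<Longrightarrow> pos_le G H"
  unfolding pos_ge_def pos_le_def
  by (metis outcome_psum_StarR_le_iff position_psum position_StarR)

theorem theorem2p19:
  fixes G :: tree
  assumes "position G"
  shows "\<not> (\<exists>H. position H \<and> pos_gt G H)"
  by (auto simp: pos_gt_def pos_ge_imp_pos_le)

end
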